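(* Let $N\ge 2$ and let $k>0$ be real. Let $\mathcal G$ be a unit weighted digraph on $N$ vertices, without self-loops, which contains at least one directed spanning tree, and let $\lambda_1,\dots,\lambda_{N-1}$ be all nonzero eigenvalues (with multiplicity) of its Laplace matrix $L(\mathcal G)$. Consider the network of $N$ agents $$\dot x_i=Ax_i+Bu_i,\qquad y_i=C^{\mathrm T}x_i,\qquad i=1,\dots,N,$$ $$A=\begin{pmatrix}0&0\\1&0\end{pmatrix},\quad B=\begin{pmatrix}2\\0\end{pmatrix},\quad C=\begin{pmatrix}0.5\\0.5\end{pmatrix},$$ whose information flow is described by $\mathcal G$, with the controller $$u_i(t)=-k\sum_{j\in\mathcal N_i}(y_i(t)-y_j(t)),\qquad i=1,\dots,N.$$ Then the controller ensures $$\lim_{t\to\infty}(x_i(t)-x_j(t))=0,\quad i,j=1,\dots,N,$$ for all initial conditions $x_1(0),\dots,x_N(0)\in\mathbb{R}^2$ if, and only if, $$k>\max_{1\le j\le N-1}\frac{\sin^2(\arg(\lambda_j))}{\mathrm{Re}\,\lambda_j}.$$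
   Context: Digraph conventions: a digraph is $\mathcal G=(\mathcal V,\mathcal E)$ with $\mathcal E\subseteq\mathcal V\times\mathcal V$ and no self-loops. In an arc $(\alpha,\beta)$ the vertex $\beta$ is called the parent (neighbour) of $\alpha$; agents are identified with vertices $1,\dots,N$ and $\mathcal N_i=\{j:(i,j)\in\mathcal E\}$ is the set of neighbours of agent $i$. A directed tree is a digraph in which all vertices except one (the root) have exactly one parent; a directed spanning tree of $\mathcal G$ is a directed tree formed by all vertices of $\mathcal G$ and some of its arcs such that there is a directed path (following arcs $(\alpha,\beta)$ from $\alpha$ to $\beta$) from every vertex to the root. Unit weighted: the adjacency matrix $\mathcal A(\mathcal G)$ has $(i,j)$ entry $1$ if $(i,j)\in\mathcal E$ and $0$ otherwise. The Laplace matrix is $L(\mathcal G)=\mathrm{diag}(\mathcal A(\mathcal G)\mathbf 1_N)-\mathcal A(\mathcal G)$, where $\mathbf 1_N$ is the all-ones vector. When $\mathcal G$ has a directed spanning tree, $0$ is a simple eigenvalue of $L(\mathcal G)$ and all other eigenvalues have positive real part. *)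

theory Defs
  imports
    "HOL-Analysis.Analysis"
    "Graph_Theory.Graph_Theory"
    "Jordan_Normal_Form.Char_Poly"
begin

text \<open>In an arc \<open>(\<alpha>, \<beta>)\<close> the vertex \<open>\<beta>\<close> is the parent of \<open>\<alpha>\<close>, so the parents of a vertex are
  its out-neighbours and their number is its out-degree; arcs point towards the root.\<close>

definition neighbours :: "'a pair_pre_digraph \<Rightarrow> 'a \<Rightarrow> 'a set" where
  "neighbours G i = {j. (i, j) \<in> parcs G}"

definition directed_tree :: "'a pair_pre_digraph \<Rightarrow> 'a \<Rightarrow> bool" where
  "directed_tree T r \<longleftrightarrow>
     pair_digraph T \<and> r \<in> pverts T \<and> out_degree (with_proj T) r = 0 \<and>
     (\<forall>v \<in> pverts T - {r}. out_degree (with_proj T) v = 1)"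

text \<open>\<open>directed_tree\<close> alone does not exclude cycles; reachability of the root does.\<close>

definition directed_spanning_tree :: "'a pair_pre_digraph \<Rightarrow> 'a pair_pre_digraph \<Rightarrow> bool" where
  "directed_spanning_tree T G \<longleftrightarrow>
     spanning (with_proj T) (with_proj G) \<and>
     (\<exists>r. directed_tree T r \<and> (\<forall>v \<in> pverts T. v \<rightarrow>\<^sup>*\<^bsub>with_proj T\<^esub> r))"

text \<open>Matrix indices run from 0 while vertices run from 1; hence the shift by \<open>Suc\<close>.\<close>

definition adjacency_matrix :: "nat \<Rightarrow> nat pair_pre_digraph \<Rightarrow> real mat" where
  "adjacency_matrix N G =
     Matrix.mat N N (\<lambda>(i, j). if (Suc i, Suc j) \<in> parcs G then 1 else 0)"

definition laplace_matrix :: "nat \<Rightarrow> nat pair_pre_digraph \<Rightarrow> real mat" where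
  "laplace_matrix N G =
     mat_diag N (vec_index (adjacency_matrix N G *\<^sub>v Matrix.vec N (\<lambda>_. 1))) - adjacency_matrix N G"

definition eigenvalue_mset :: "real mat \<Rightarrow> complex multiset" where
  "eigenvalue_mset M = proots (char_poly (map_mat complex_of_real M))"

definition A_mat :: "real^2^2" where
  "A_mat = vector [vector [0, 0], vector [1, 0]]"

definition B_vec :: "real^2" where
  "B_vec = vector [2, 0]"

definition C_vec :: "real^2" where
  "C_vec = vector [1/2, 1/2]"

definition agent_network ::
  "nat \<Rightarrow> (nat \<Rightarrow> real \<Rightarrow> real^2) \<Rightarrow> (nat \<Rightarrow> real \<Rightarrow> real) \<Rightarrow> (nat \<Rightarrow> real \<Rightarrow> real) \<Rightarrow> bool" where
  "agent_network N x u y \<longleftrightarrow>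
     (\<forall>i\<in>{1..N}. \<forall>t\<ge>0.
        (x i has_vector_derivative (A_mat *v x i t + u i t *\<^sub>R B_vec)) (at t within {0..}) \<and>
        y i t = inner C_vec (x i t))"

definition output_feedback ::
  "nat \<Rightarrow> nat pair_pre_digraph \<Rightarrow> real \<Rightarrow> (nat \<Rightarrow> real \<Rightarrow> real) \<Rightarrow> (nat \<Rightarrow> real \<Rightarrow> real) \<Rightarrow> bool" where
  "output_feedback N G k u y \<longleftrightarrow>
     (\<forall>i\<in>{1..N}. \<forall>t\<ge>0. u i t = - k * (\<Sum>j\<in>neighbours G i. y i t - y j t))"

end

theory Submission
  imports Defs "HOL-Real_Asymp.Real_Asymp" "Jordan_Normal_Form.Schur_Decomposition"
begin

text \<open>Writing \<open>q\<close> and \<open>p = q'\<close> for the vectors of second and first components, the closed loop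
  is \<open>q'' = - k L (q' + q)\<close>, so an eigenvalue \<open>\<lambda>\<close> of \<open>L\<close> contributes the modes
  \<open>s\<^sup>2 + k \<lambda> s + k \<lambda> = 0\<close>, and the bound on \<open>k\<close> says that these are stable for all \<open>\<lambda> \<noteq> 0\<close>.
  For sufficiency \<open>L\<close> need not be diagonalisable: a Schur triangularisation with \<open>0\<close> as first
  diagonal entry turns the system into a cascade in which every component but the first is a stable
  scalar oscillator with vanishing input; the first component is common to all agents, because
  \<open>L 1 = 0\<close> and \<open>0\<close> is a simple eigenvalue. For necessity, an unstable \<open>s\<close> and an
  eigenvector \<open>v\<close> of \<open>L\<close> give the real trajectories \<open>Re (c e\<^sup>s\<^sup>t v)\<close> with \<open>c \<in> {1, \<i>}\<close>, which
  cannot both reach consensus. Simplicity of \<open>0\<close> follows by counting, as the nonzero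
  eigenvalues are indexed by \<open>N - 1\<close> numbers.\<close>

section \<open>Scalar oscillators: decay and location of the characteristic roots\<close>

text \<open>With the integrating factor, \<open>h = exp (- s t) f\<close> has derivative
  \<open>exp (- s t) g\<close>. Once \<open>g\<close> is small, the mean value inequality bounds the
  growth of \<open>h\<close> by that of \<open>d / \<sigma> * exp (\<sigma> t)\<close>; multiplying
  back leaves a decaying term plus a small constant.\<close>

lemma stable_first_order_tendsto_0:
  fixes f g :: "real \<Rightarrow> complex"
  assumes f: "\<And>t. t \<ge> 0 \<Longrightarrow> (f has_vector_derivative (s * f t + g t)) (at t within {0..})"
    and s: "Re s < 0" and g: "(g \<longlongrightarrow> 0) at_top"
  shows "(f \<longlongrightarrow> 0) at_top"
proof (rule tendstoI)
  fix e :: real assume e: "e > 0"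
  define \<sigma> where "\<sigma> = - Re s"
  have \<sigma>: "\<sigma> > 0" using s by (simp add: \<sigma>_def)
  \<comment> \<open>Chosen so that \<open>d / \<sigma> = e / 2\<close>; the other half of
    \<open>e\<close> is left to the decaying contribution of \<open>h T\<close>.\<close>
  define d where "d = e * \<sigma> / 2"
  have d: "d > 0" using e \<sigma> by (simp add: d_def)
  have "eventually (\<lambda>t. norm (g t) < d) at_top"
    using tendstoD[OF g d] by simp
  then obtain T0 where T0: "\<And>t. t \<ge> T0 \<Longrightarrow> norm (g t) < d"
    by (auto simp: eventually_at_top_linorder)
  define T where "T = max T0 0"
  have T: "T \<ge> 0" "\<And>t. t \<ge> T \<Longrightarrow> norm (g t) < d" using T0 by (auto simp: T_def)
  define h where "h = (\<lambda>t. exp (complex_of_real t * (-s)) * f t)"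
  have h: "(h has_vector_derivative exp (complex_of_real t * (-s)) * g t) (at t within {0..})" if "t \<ge> 0" for t
  proof -
    have "((\<lambda>t. exp (complex_of_real t * (-s))) has_vector_derivative exp (complex_of_real t * (-s)) * (-s)) (at t within {0..})"
      using exp_scaleR_has_vector_derivative_right[of "-s" t "{0..}"] by (simp add: scaleR_conv_of_real)
    from has_vector_derivative_mult[OF this f[OF that]]
    show ?thesis unfolding h_def by (simp add: algebra_simps)
  qed
  have bound: "norm (h t - h T) \<le> d / \<sigma> * exp (\<sigma> * t) - d / \<sigma> * exp (\<sigma> * T)" if t: "t > T" for t
  proof (rule differentiable_bound_general[OF t, where f' = "\<lambda>t. exp (complex_of_real t * (-s)) * g t"
        and \<phi>' = "\<lambda>t. d * exp (\<sigma> * t)"])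
    show "continuous_on {T..t} (\<lambda>t. d / \<sigma> * exp (\<sigma> * t))" by (intro continuous_intros)
    show "continuous_on {T..t} h"
      unfolding continuous_on_eq_continuous_within
    proof
      fix x assume "x \<in> {T..t}"
      then show "continuous (at x within {T..t}) h"
        using has_vector_derivative_continuous[OF has_vector_derivative_within_subset[OF h]] T(1)
        by auto
    qed
    fix x assume x: "T < x" "x < t"
    then show "(h has_vector_derivative exp (complex_of_real x * (-s)) * g x) (at x)"
      using h[of x] T(1) by (simp add: at_within_interior[of x "{0..}"])
    show "((\<lambda>t. d / \<sigma> * exp (\<sigma> * t)) has_vector_derivative d * exp (\<sigma> * x)) (at x)"
      using \<sigma> by (auto intro!: derivative_eq_intros simp: has_real_derivative_iff_has_vector_derivative[symmetric])
    show "norm (exp (complex_of_real x * (-s)) * g x) \<le> d * exp (\<sigma> * x)"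
      using T(2)[of x] x by (simp add: norm_mult \<sigma>_def mult.commute)
  qed
  have est: "norm (f t) \<le> exp (- \<sigma> * t) * norm (h T) + e / 2" if t: "t > T" for t
  proof -
    have "norm (h t) = exp (\<sigma> * t) * norm (f t)"
      by (simp add: h_def norm_mult \<sigma>_def mult.commute)
    moreover have "norm (h t) \<le> norm (h T) + d / \<sigma> * exp (\<sigma> * t)"
      using bound[OF t] norm_triangle_sub[of "h t" "h T"] d \<sigma> by (smt (verit) divide_pos_pos exp_gt_zero mult_pos_pos)
    ultimately have "exp (- \<sigma> * t) * (exp (\<sigma> * t) * norm (f t)) \<le> exp (- \<sigma> * t) * (norm (h T) + d / \<sigma> * exp (\<sigma> * t))"
      by (intro mult_left_mono) auto
    moreover have 1: "exp (- \<sigma> * t) * exp (\<sigma> * t) = 1" by (simp flip: exp_add)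
    moreover have "d / \<sigma> = e / 2" using \<sigma> by (simp add: d_def)
    ultimately have "(exp (- \<sigma> * t) * exp (\<sigma> * t)) * norm (f t)
        \<le> exp (- \<sigma> * t) * norm (h T) + e / 2 * (exp (- \<sigma> * t) * exp (\<sigma> * t))"
      by (simp add: distrib_left mult_ac)
    then show ?thesis unfolding 1 by simp
  qed
  have "((\<lambda>t. exp (- \<sigma> * t) * norm (h T)) \<longlongrightarrow> 0) at_top"
    using \<sigma> by real_asymp
  from tendstoD[OF this, of "e/2"] e
  have "eventually (\<lambda>t. exp (- \<sigma> * t) * norm (h T) < e / 2) at_top" by simp
  then show "eventually (\<lambda>t. dist (f t) 0 < e) at_top"
    using eventually_gt_at_top[of T]
  proof eventually_elim
    case (elim t) then show ?case using est[of t] by simp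
  qed
qed

text \<open>The operator factors as \<open>(d/dt - s\<^sub>2) (d/dt - s\<^sub>1)\<close>:
  \<open>w = \<eta>' - s\<^sub>1 \<eta>\<close> solves a first-order equation with input
  \<open>g\<close>, and \<open>\<eta>\<close> one with input \<open>w\<close>. Coinciding roots are
  covered as well.\<close>

lemma stable_second_order_tendsto_0:
  fixes \<eta> \<pi> g :: "real \<Rightarrow> complex"
  assumes \<eta>: "\<And>t. t \<ge> 0 \<Longrightarrow> (\<eta> has_vector_derivative \<pi> t) (at t within {0..})"
    and \<pi>: "\<And>t. t \<ge> 0 \<Longrightarrow> (\<pi> has_vector_derivative ((s\<^sub>1 + s\<^sub>2) * \<pi> t - s\<^sub>1 * s\<^sub>2 * \<eta> t + g t)) (at t within {0..})"
    and s: "Re s\<^sub>1 < 0" "Re s\<^sub>2 < 0" and g: "(g \<longlongrightarrow> 0) at_top"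
  shows "(\<eta> \<longlongrightarrow> 0) at_top" "(\<pi> \<longlongrightarrow> 0) at_top"
proof -
  define w where "w = (\<lambda>t. \<pi> t - s\<^sub>1 * \<eta> t)"
  have "(w has_vector_derivative (s\<^sub>2 * w t + g t)) (at t within {0..})" if "t \<ge> 0" for t
    using has_vector_derivative_diff[OF \<pi>[OF that] has_vector_derivative_mult_right[OF \<eta>[OF that], of s\<^sub>1]]
    by (simp add: w_def algebra_simps)
  then have w: "(w \<longlongrightarrow> 0) at_top"
    using s(2) g by (rule stable_first_order_tendsto_0)
  show \<eta>0: "(\<eta> \<longlongrightarrow> 0) at_top"
    by (rule stable_first_order_tendsto_0[OF _ s(1) w]) (use \<eta> in \<open>simp add: w_def\<close>)
  have "((\<lambda>t. w t + s\<^sub>1 * \<eta> t) \<longlongrightarrow> 0 + s\<^sub>1 * 0) at_top"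
    by (intro tendsto_intros w \<eta>0)
  then show "(\<pi> \<longlongrightarrow> 0) at_top" by (simp add: w_def)
qed

text \<open>With \<open>w = 1 / s\<close> the polynomial \<open>s\<^sup>2 + \<mu> s + \<mu>\<close> becomes \<open>w\<^sup>2 + w + 1 / \<mu>\<close>, whose roots sum
  to \<open>-1\<close>; hence both lie in the left half plane iff one of them has real part in \<open>(-1, 0)\<close>.\<close>

lemma parabola_iff_strip:
  fixes w :: complex
  shows "Re (- w - w\<^sup>2) > (Im (- w - w\<^sup>2))\<^sup>2 \<longleftrightarrow> -1 < Re w \<and> Re w < 0"
proof -
  obtain a b where w: "w = Complex a b" by (cases w)
  \<comment> \<open>Both lines \<open>Re w = 0\<close> and \<open>Re w = -1\<close> are mapped to
    the parabola \<open>Re z = (Im z)\<^sup>2\<close>, hence the factors \<open>a\<close> and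
    \<open>1 + a\<close>.\<close>
  have "Re (- w - w\<^sup>2) - (Im (- w - w\<^sup>2))\<^sup>2 = - (a * (1 + a)) * (1 + 4 * b\<^sup>2)"
    by (simp add: w power2_eq_square algebra_simps)
  moreover have "1 + 4 * b\<^sup>2 > 0" by (simp add: add_pos_nonneg)
  ultimately have "Re (- w - w\<^sup>2) > (Im (- w - w\<^sup>2))\<^sup>2 \<longleftrightarrow> - (a * (1 + a)) > 0"
    by (metis diff_gt_0_iff_gt zero_less_mult_pos2 mult_pos_pos)
  also have "\<dots> \<longleftrightarrow> -1 < a \<and> a < 0" by (auto simp: mult_less_0_iff)
  finally show ?thesis by (simp add: w)
qed

text \<open>The roots are \<open>1 / w\<close> and \<open>1 / (-1 - w)\<close>, and inversion
  preserves the sign of the real part. Multiplied by the squared modulus of \<open>\<mu>\<close>,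
  the parabola inequality for \<open>inverse \<mu>\<close> becomes the one with
  \<open>sin (Arg \<mu>)\<close>.\<close>

lemma hurwitz_condition:
  fixes \<mu> :: complex
  assumes "\<mu> \<noteq> 0"
  obtains s\<^sub>1 s\<^sub>2 where "s\<^sub>1 + s\<^sub>2 = - \<mu>" "s\<^sub>1 * s\<^sub>2 = \<mu>"
    "Re \<mu> > (sin (Arg \<mu>))\<^sup>2 \<longleftrightarrow> Re s\<^sub>1 < 0 \<and> Re s\<^sub>2 < 0"
proof -
  \<comment> \<open>The quadratic formula for \<open>w\<^sup>2 + w + 1 / \<mu> = 0\<close>; the
    other root is \<open>-1 - w\<close>.\<close>
  define w where "w = (-1 + csqrt (1 - 4 / \<mu>)) / 2"
  have "2 * w + 1 = csqrt (1 - 4 / \<mu>)" unfolding w_def by (simp add: field_simps)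
  then have "(2 * w + 1)\<^sup>2 = 1 - 4 / \<mu>" by simp
  then have "4 * (w * w + w + 1 / \<mu>) = 0"
    by (simp add: power2_eq_square algebra_simps)
  then have w: "w * (-1 - w) = 1 / \<mu>"
    unfolding mult_eq_0_iff by (simp add: algebra_simps add_eq_0_iff)
  have nz: "w \<noteq> 0" "-1 - w \<noteq> 0" using w assms by auto
  have "1 / w + 1 / (-1 - w) = - 1 / (w * (-1 - w))"
    using nz by (simp add: add_frac_eq)
  then have sum: "1 / w + 1 / (-1 - w) = - \<mu>" unfolding w by simp
  have "1 / w * (1 / (-1 - w)) = 1 / (w * (-1 - w))" by simp
  then have prod: "1 / w * (1 / (-1 - w)) = \<mu>" unfolding w by simp
  have Re_neg: "Re (1 / z) < 0 \<longleftrightarrow> Re z < 0" if "z \<noteq> 0" for z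
  proof -
    have "(Re z)\<^sup>2 + (Im z)\<^sup>2 > 0" using that by (simp add: complex_eq_iff sum_power2_gt_zero_iff)
    then show ?thesis by (auto simp: Re_divide divide_less_0_iff)
  qed
  have nu: "- w - w\<^sup>2 = inverse \<mu>"
    using w by (simp add: power2_eq_square algebra_simps inverse_eq_divide)
  define r where "r = (cmod \<mu>)\<^sup>2"
  have r: "r > 0" using assms by (simp add: r_def)
  have Re: "Re (inverse \<mu>) = Re \<mu> / r" and Im: "Im (inverse \<mu>) = - Im \<mu> / r"
    by (simp_all add: cmod_power2 r_def)
  have "Im \<mu> = cmod \<mu> * sin (Arg \<mu>)"
    using assms by (metis Im_rcis rcis_cmod_Arg)
  then have "(Im \<mu>)\<^sup>2 = r * (sin (Arg \<mu>))\<^sup>2"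
    by (simp add: r_def power_mult_distrib)
  then have "(Im (inverse \<mu>))\<^sup>2 = (sin (Arg \<mu>))\<^sup>2 / r"
    unfolding Im using r by (simp add: power_divide power2_eq_square)
  then have "Re (- w - w\<^sup>2) > (Im (- w - w\<^sup>2))\<^sup>2 \<longleftrightarrow> Re \<mu> > (sin (Arg \<mu>))\<^sup>2"
    unfolding nu Re using r by (simp add: divide_less_cancel)
  then have "Re \<mu> > (sin (Arg \<mu>))\<^sup>2 \<longleftrightarrow> Re (1 / w) < 0 \<and> Re (1 / (-1 - w)) < 0"
    unfolding parabola_iff_strip Re_neg[OF nz(1)] Re_neg[OF nz(2)] by auto
  with sum prod show ?thesis by (rule that)
qed

section \<open>Decoupling by Schur triangularisation\<close>

text \<open>Back substitution: row \<open>l\<close> is driven only by later components, which vanish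
  by induction. Components before \<open>m\<close> never act on those from \<open>m\<close> on, so
  with \<open>m = 1\<close> the mode of the eigenvalue 0 can be left aside.\<close>

lemma triangular_cascade_tendsto_0:
  fixes \<eta> \<pi> :: "nat \<Rightarrow> real \<Rightarrow> complex" and b :: "nat \<Rightarrow> nat \<Rightarrow> complex"
  assumes \<eta>: "\<And>l t. l < n \<Longrightarrow> t \<ge> 0 \<Longrightarrow> (\<eta> l has_vector_derivative \<pi> l t) (at t within {0..})"
    and \<pi>: "\<And>l t. l < n \<Longrightarrow> t \<ge> 0 \<Longrightarrow>
      (\<pi> l has_vector_derivative - (\<Sum>j<n. b l j * (\<pi> j t + \<eta> j t))) (at t within {0..})"
    and tri: "\<And>l j. j < l \<Longrightarrow> l < n \<Longrightarrow> b l j = 0"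
    and diag: "\<And>l. m \<le> l \<Longrightarrow> l < n \<Longrightarrow>
      \<exists>s\<^sub>1 s\<^sub>2. Re s\<^sub>1 < 0 \<and> Re s\<^sub>2 < 0 \<and> s\<^sub>1 + s\<^sub>2 = - b l l \<and> s\<^sub>1 * s\<^sub>2 = b l l"
    and "m \<le> l" "l < n"
  shows "(\<eta> l \<longlongrightarrow> 0) at_top \<and> (\<pi> l \<longlongrightarrow> 0) at_top"
  using \<open>m \<le> l\<close> \<open>l < n\<close>
proof (induction "n - l" arbitrary: l rule: less_induct)
  case less
  define g where "g = (\<lambda>t. - (\<Sum>j\<in>{l<..<n}. b l j * (\<pi> j t + \<eta> j t)))"
  have split: "- (\<Sum>j<n. b l j * (\<pi> j t + \<eta> j t)) = - b l l * (\<pi> l t + \<eta> l t) + g t" for t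
  proof -
    have "(\<Sum>j<n. b l j * (\<pi> j t + \<eta> j t)) = (\<Sum>j\<in>insert l {l<..<n}. b l j * (\<pi> j t + \<eta> j t))"
      using less.prems tri by (intro sum.mono_neutral_right) (auto simp: not_less)
    then show ?thesis by (simp add: g_def)
  qed
  have IH: "(\<eta> j \<longlongrightarrow> 0) at_top" "(\<pi> j \<longlongrightarrow> 0) at_top" if "j \<in> {l<..<n}" for j
    using less.hyps[of j] less.prems that by auto
  have "(g \<longlongrightarrow> - (\<Sum>j\<in>{l<..<n}. b l j * (0 + 0))) at_top"
    unfolding g_def by (intro tendsto_intros IH)
  then have g: "(g \<longlongrightarrow> 0) at_top" by simp
  obtain s\<^sub>1 s\<^sub>2 where s: "Re s\<^sub>1 < 0" "Re s\<^sub>2 < 0" "s\<^sub>1 + s\<^sub>2 = - b l l" "s\<^sub>1 * s\<^sub>2 = b l l"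
    using diag[OF less.prems] by blast
  have "(\<pi> l has_vector_derivative ((s\<^sub>1 + s\<^sub>2) * \<pi> l t - s\<^sub>1 * s\<^sub>2 * \<eta> l t + g t)) (at t within {0..})"
    if "t \<ge> 0" for t
    using \<pi>[OF less.prems(2) that] unfolding split s by (simp add: algebra_simps)
  from stable_second_order_tendsto_0[OF \<eta>[OF less.prems(2)] this s(1,2) g]
  show ?case by blast
qed

text \<open>Back substitution again. With \<open>m = 1\<close> it shows that the all-ones vector has
  only its component 0 in Schur coordinates.\<close>

lemma upper_triangular_kernel:
  fixes B :: "complex mat"
  assumes tri: "\<And>l j. j < l \<Longrightarrow> l < n \<Longrightarrow> B $$ (l, j) = 0"
    and diag: "\<And>l. m \<le> l \<Longrightarrow> l < n \<Longrightarrow> B $$ (l, l) \<noteq> 0"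
    and ker: "\<And>l. l < n \<Longrightarrow> (\<Sum>j<n. B $$ (l, j) * \<xi> j) = 0"
    and "m \<le> l" "l < n"
  shows "\<xi> l = 0"
  using \<open>m \<le> l\<close> \<open>l < n\<close>
proof (induction "n - l" arbitrary: l rule: less_induct)
  case less
  have "(\<Sum>j<n. B $$ (l, j) * \<xi> j) = (\<Sum>j\<in>{l}. B $$ (l, j) * \<xi> j)"
  proof (rule sum.mono_neutral_right)
    show "\<forall>j\<in>{..<n} - {l}. B $$ (l, j) * \<xi> j = 0"
      using less.prems less.hyps tri by (metis DiffE insertI1 lessThan_iff linorder_neqE_nat
          diff_less_mono2 le_trans less_imp_le mult_eq_0_iff)
  qed (use less.prems in auto)
  then show ?case using ker[OF less.prems(2)] diag[OF less.prems] by simp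
qed

text \<open>Schur coordinates from 1 on decay. Coordinate 0 need not, but it reaches agent
  \<open>i\<close> with the factor \<open>P $$ (i, 0)\<close>, which is the same for all agents: the
  all-ones vector is a multiple of column 0 of \<open>P\<close>. Differences between agents
  therefore cancel it.\<close>

lemma consensus_of_stable_modes:
  fixes L :: "complex mat" and q p :: "nat \<Rightarrow> real \<Rightarrow> complex"
  assumes L: "L \<in> carrier_mat n n"
    and rowsum: "\<And>i. i < n \<Longrightarrow> (\<Sum>j<n. L $$ (i, j)) = 0"
    and cp: "char_poly L = (\<Prod>a\<leftarrow>0 # es. [:- a, 1:])"
    and nz: "0 \<notin> set es"
    and stable: "\<And>a. a \<in> set es \<Longrightarrow>
      \<exists>s\<^sub>1 s\<^sub>2. Re s\<^sub>1 < 0 \<and> Re s\<^sub>2 < 0 \<and> s\<^sub>1 + s\<^sub>2 = - (k * a) \<and> s\<^sub>1 * s\<^sub>2 = k * a"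
    and q: "\<And>i t. i < n \<Longrightarrow> t \<ge> 0 \<Longrightarrow> (q i has_vector_derivative p i t) (at t within {0..})"
    and p: "\<And>i t. i < n \<Longrightarrow> t \<ge> 0 \<Longrightarrow>
      (p i has_vector_derivative - k * (\<Sum>j<n. L $$ (i, j) * (p j t + q j t))) (at t within {0..})"
    and "i < n" "j < n"
  shows "((\<lambda>t. q i t - q j t) \<longlongrightarrow> 0) at_top" "((\<lambda>t. p i t - p j t) \<longlongrightarrow> 0) at_top"
proof -
  \<comment> \<open>The diagonal of \<open>B\<close> follows the order of the list, so the
    eigenvalue 0 sits at index 0.\<close>
  obtain B P Q where sd: "schur_decomposition L (0 # es) = (B, P, Q)"
    by (metis prod_cases3)
  from schur_decomposition[OF L cp sd] have wit: "similar_mat_wit L B P Q"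
    and ut: "upper_triangular B" and dg: "diag_mat B = 0 # es" by auto
  note w = similar_mat_witD2[OF L wit]
  have tri: "B $$ (l, j) = 0" if "j < l" "l < n" for l j
    using upper_triangularD[OF ut] that w by auto
  have diag: "B $$ (l, l) \<in> set es" if "1 \<le> l" "l < n" for l
  proof -
    have "B $$ (l, l) = diag_mat B ! l" using w that by (simp add: diag_mat_def)
    moreover have "length (diag_mat B) = n" using w by (simp add: diag_mat_def)
    ultimately show ?thesis using that unfolding dg by (cases l) (auto simp: in_set_conv_nth)
  qed
  have "Q * L = Q * (P * (B * Q))"
    using w by (simp add: assoc_mult_mat[of P n n B n Q n])
  also have "\<dots> = (Q * P) * (B * Q)"
    by (rule assoc_mult_mat[symmetric]) (use w in \<open>auto intro: mult_carrier_mat\<close>)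
  also have "\<dots> = B * Q" unfolding w(2) using w by simp
  finally have QL: "Q * L = B * Q" .
  have QL': "(\<Sum>m<n. Q $$ (l, m) * L $$ (m, j)) = (\<Sum>m<n. B $$ (l, m) * Q $$ (m, j))"
    if "l < n" "j < n" for l j
    using arg_cong[OF QL, of "\<lambda>M. M $$ (l, j)"] that w L
    by (simp add: scalar_prod_def atLeast0LessThan)
  have PQ': "(\<Sum>m<n. P $$ (i, m) * Q $$ (m, j)) = (if i = j then 1 else 0)"
    if "i < n" "j < n" for i j
  proof -
    have "(P * Q) $$ (i, j) = (\<Sum>m<n. P $$ (i, m) * Q $$ (m, j))"
      using that w(6,7) by (simp add: scalar_prod_def atLeast0LessThan)
    then show ?thesis unfolding w(1) using that by simp
  qed
  \<comment> \<open>The Schur coordinates of a family \<open>f\<close>, generic in \<open>f\<close>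
    because \<open>q\<close>, \<open>p\<close>, their sum and the constant 1 are all
    transformed.\<close>
  define \<eta> where "\<eta> = (\<lambda>f l (t::real). \<Sum>m<n. Q $$ (l, m) * (f m t :: complex))"
  have expand: "f i t = (\<Sum>l<n. P $$ (i, l) * \<eta> f l t)" if "i < n" for f i t
  proof -
    have "(\<Sum>l<n. P $$ (i, l) * \<eta> f l t) = (\<Sum>l<n. \<Sum>m<n. (P $$ (i, l) * Q $$ (l, m)) * f m t)"
      by (simp add: \<eta>_def sum_distrib_left mult_ac)
    also have "\<dots> = (\<Sum>m<n. (\<Sum>l<n. P $$ (i, l) * Q $$ (l, m)) * f m t)"
      by (subst sum.swap) (simp add: sum_distrib_right)
    also have "\<dots> = (\<Sum>m<n. if i = m then f m t else 0)"
      by (rule sum.cong) (auto simp: PQ' that)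
    also have "\<dots> = f i t" using that by simp
    finally show ?thesis by simp
  qed
  have commute: "(\<Sum>m<n. Q $$ (l, m) * (\<Sum>j<n. L $$ (m, j) * f j t)) = (\<Sum>j<n. B $$ (l, j) * \<eta> f j t)"
    if "l < n" for l f t
  proof -
    have "(\<Sum>m<n. Q $$ (l, m) * (\<Sum>j<n. L $$ (m, j) * f j t))
        = (\<Sum>m<n. \<Sum>j<n. (Q $$ (l, m) * L $$ (m, j)) * f j t)"
      by (simp add: sum_distrib_left mult_ac)
    also have "\<dots> = (\<Sum>j<n. (\<Sum>m<n. Q $$ (l, m) * L $$ (m, j)) * f j t)"
      by (subst sum.swap) (simp add: sum_distrib_right)
    also have "\<dots> = (\<Sum>j<n. (\<Sum>m<n. B $$ (l, m) * Q $$ (m, j)) * f j t)"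
      by (rule sum.cong) (simp_all add: QL' that)
    also have "\<dots> = (\<Sum>m<n. \<Sum>j<n. (B $$ (l, m) * Q $$ (m, j)) * f j t)"
      by (subst sum.swap) (simp add: sum_distrib_right)
    also have "\<dots> = (\<Sum>m<n. B $$ (l, m) * \<eta> f m t)"
      by (simp add: \<eta>_def sum_distrib_left mult_ac)
    finally show ?thesis .
  qed
  have modes: "(\<eta> q l \<longlongrightarrow> 0) at_top \<and> (\<eta> p l \<longlongrightarrow> 0) at_top" if "1 \<le> l" "l < n" for l
  proof (rule triangular_cascade_tendsto_0[where b = "\<lambda>l j. k * B $$ (l, j)", OF _ _ _ _ that])
    fix l t assume l: "l < n" and t: "(t::real) \<ge> 0"
    show "(\<eta> q l has_vector_derivative \<eta> p l t) (at t within {0..})"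
      unfolding \<eta>_def using t
      by (intro has_vector_derivative_sum has_vector_derivative_mult_right q) auto
    have "(\<eta> p l has_vector_derivative
        (\<Sum>m<n. Q $$ (l, m) * (- k * (\<Sum>j<n. L $$ (m, j) * (p j t + q j t))))) (at t within {0..})"
      unfolding \<eta>_def using t
      by (intro has_vector_derivative_sum has_vector_derivative_mult_right p) auto
    also have "(\<Sum>m<n. Q $$ (l, m) * (- k * (\<Sum>j<n. L $$ (m, j) * (p j t + q j t))))
        = - k * (\<Sum>m<n. Q $$ (l, m) * (\<Sum>j<n. L $$ (m, j) * (p j t + q j t)))"
      by (subst sum_distrib_left[of "- k"]) (rule sum.cong[OF refl], rule mult.left_commute)
    also have "\<dots> = - k * (\<Sum>j<n. B $$ (l, j) * \<eta> (\<lambda>j t. p j t + q j t) j t)"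
      by (subst commute[OF l, of "\<lambda>j t. p j t + q j t"]) (rule refl)
    also have "\<dots> = - (\<Sum>j<n. k * B $$ (l, j) * (\<eta> p j t + \<eta> q j t))"
      by (simp add: \<eta>_def sum.distrib distrib_left sum_distrib_left mult_ac sum_negf)
    finally show "(\<eta> p l has_vector_derivative - (\<Sum>j<n. k * B $$ (l, j) * (\<eta> p j t + \<eta> q j t)))
        (at t within {0..})" .
  qed (use tri diag stable in auto)
  \<comment> \<open>The constant family is the all-ones vector, in the kernel of \<open>L\<close> by
    \<open>rowsum\<close>; the time 0 is a dummy.\<close>
  have \<xi>: "\<eta> (\<lambda>_ _. 1) l 0 = 0" if "1 \<le> l" "l < n" for l
  proof (rule upper_triangular_kernel[where B = B and \<xi> = "\<lambda>l. \<eta> (\<lambda>_ _. 1) l 0", OF _ _ _ that])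
    fix l assume l: "l < n"
    show "(\<Sum>j<n. B $$ (l, j) * \<eta> (\<lambda>_ _. 1) j 0) = 0"
      using commute[OF l, of "\<lambda>_ _. 1" 0] by (simp add: rowsum)
  next
    fix l assume "1 \<le> l" "l < n"
    then show "B $$ (l, l) \<noteq> 0" using diag[of l] nz by metis
  qed (use tri in auto)
  have "n > 0" using \<open>i < n\<close> by simp
  then have insert0: "{..<n} = insert 0 {1..<n}" by auto
  have P0: "P $$ (i, 0) * \<eta> (\<lambda>_ _. 1) 0 0 = 1" if "i < n" for i
    using expand[OF that, of "\<lambda>_ _. 1" 0] \<xi> unfolding insert0 by simp
  have "P $$ (i, 0) = P $$ (j, 0)"
    using P0[OF \<open>i < n\<close>] P0[OF \<open>j < n\<close>] by (metis mult_cancel_right zero_neq_one mult_zero_right)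
  then have diff: "f i t - f j t = (\<Sum>l\<in>{1..<n}. (P $$ (i, l) - P $$ (j, l)) * \<eta> f l t)" for f t
    unfolding expand[OF \<open>i < n\<close>, of f t] expand[OF \<open>j < n\<close>, of f t] insert0
    by (simp add: sum_subtractf left_diff_distrib)
  have "((\<lambda>t. f i t - f j t) \<longlongrightarrow> 0) at_top"
    if "\<And>l. 1 \<le> l \<Longrightarrow> l < n \<Longrightarrow> (\<eta> f l \<longlongrightarrow> 0) at_top" for f
  proof -
    have "((\<lambda>t. f i t - f j t) \<longlongrightarrow> (\<Sum>l\<in>{1..<n}. (P $$ (i, l) - P $$ (j, l)) * 0)) at_top"
      unfolding diff by (intro tendsto_intros that) auto
    then show ?thesis by simp
  qed
  from this[of q] this[of p] modes
  show "((\<lambda>t. q i t - q j t) \<longlongrightarrow> 0) at_top" "((\<lambda>t. p i t - p j t) \<longlongrightarrow> 0) at_top" by blast+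
qed

section \<open>Laplace matrices and their eigenvalues\<close>

lemma neighbours_subset:
  assumes "pair_digraph G" "pverts G = V"
  shows "neighbours G i \<subseteq> V"
proof -
  interpret pair_digraph G by fact
  show ?thesis
    using arc_snd_in_verts assms(2) by (force simp: neighbours_def)
qed

text \<open>The bridge from matrix indices, starting at 0, to agents, starting at 1. Complex values
  of \<open>f\<close> serve both eigenvectors and complexified trajectories.\<close>

lemma laplace_matrix_row:
  fixes f :: "nat \<Rightarrow> complex"
  assumes "neighbours G (Suc i) \<subseteq> {1..N}" and i: "i < N"
  shows "(\<Sum>j<N. complex_of_real (laplace_matrix N G $$ (i, j)) * f (Suc j))
    = (\<Sum>j\<in>neighbours G (Suc i). f (Suc i) - f j)"
proof -
  define a where "a = (\<lambda>j. if Suc j \<in> neighbours G (Suc i) then 1 else 0 :: real)"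
  have adj: "(\<Sum>j<N. of_real (a j) * g (Suc j)) = (\<Sum>j\<in>neighbours G (Suc i). g j)"
    for g :: "nat \<Rightarrow> 'b::{real_algebra_1}"
  proof -
    have "(\<Sum>j<N. of_real (a j) * g (Suc j))
        = (\<Sum>j\<in>{1..N}. if j \<in> neighbours G (Suc i) then g j else 0)"
      by (rule sum.reindex_bij_witness[of _ "\<lambda>j. j - 1" Suc]) (auto simp: a_def)
    also have "\<dots> = (\<Sum>j\<in>{1..N} \<inter> neighbours G (Suc i). g j)"
      by (simp add: sum.inter_restrict)
    also have "{1..N} \<inter> neighbours G (Suc i) = neighbours G (Suc i)" using assms by auto
    finally show ?thesis .
  qed
  have "laplace_matrix N G $$ (i, j)
      = (if i = j then \<Sum>m<N. a m else 0) - a j" if "j < N" for j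
    using that i by (simp add: laplace_matrix_def adjacency_matrix_def mat_diag_def a_def
        neighbours_def scalar_prod_def atLeast0LessThan)
  then have "(\<Sum>j<N. complex_of_real (laplace_matrix N G $$ (i, j)) * f (Suc j))
      = (\<Sum>j<N. complex_of_real ((if i = j then \<Sum>m<N. a m else 0) - a j) * f (Suc j))"
    by (intro sum.cong) auto
  also have "\<dots> = (\<Sum>j<N. (if i = j then complex_of_real (\<Sum>m<N. a m) * f (Suc j) else 0)
      - of_real (a j) * f (Suc j))"
    by (intro sum.cong) (auto simp: algebra_simps)
  also have "\<dots> = complex_of_real (\<Sum>m<N. a m) * f (Suc i) - (\<Sum>j\<in>neighbours G (Suc i). f j)"
    using i by (simp add: sum_subtractf adj)
  also have "complex_of_real (\<Sum>m<N. a m) * f (Suc i) = (\<Sum>j\<in>neighbours G (Suc i). f (Suc i))"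
    using adj[of "\<lambda>_. f (Suc i)"] by (simp add: sum_distrib_right)
  finally show ?thesis by (simp add: sum_subtractf)
qed

text \<open>The disc of Gershgorin belonging to an entry of largest modulus is centred at the row's
  diagonal entry and touches the imaginary axis only in \<open>0\<close>.\<close>

lemma laplace_eigenvalue_Re_pos:
  fixes f :: "nat \<Rightarrow> complex"
  assumes nb: "\<And>i. neighbours G i \<subseteq> V" and V: "finite V"
    and eig: "\<And>i. i \<in> V \<Longrightarrow> \<alpha> * f i = (\<Sum>j\<in>neighbours G i. f i - f j)"
    and f: "i\<^sub>0 \<in> V" "f i\<^sub>0 \<noteq> 0" and "\<alpha> \<noteq> 0"
  shows "Re \<alpha> > 0"
proof -
  have "Max ((\<lambda>i. cmod (f i)) ` V) \<in> (\<lambda>i. cmod (f i)) ` V"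
    using V f by (intro Max_in) auto
  then obtain i where i: "i \<in> V" and "Max ((\<lambda>i. cmod (f i)) ` V) = cmod (f i)" by auto
  with V have max: "cmod (f j) \<le> cmod (f i)" if "j \<in> V" for j
    using that by (metis Max_ge finite_imageI imageI)
  have fi: "cmod (f i) > 0" using max[OF f(1)] f(2) by (smt (verit) zero_less_norm_iff)
  define d where "d = real (card (neighbours G i))"
  have "(of_real d - \<alpha>) * f i = (\<Sum>j\<in>neighbours G i. f j)"
    using eig[OF i] by (simp add: sum_subtractf d_def left_diff_distrib)
  then have "cmod (of_real d - \<alpha>) * cmod (f i) \<le> (\<Sum>j\<in>neighbours G i. cmod (f j))"
    by (metis norm_mult norm_sum)
  also have "\<dots> \<le> (\<Sum>j\<in>neighbours G i. cmod (f i))"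
    using nb by (intro sum_mono max) auto
  also have "\<dots> = d * cmod (f i)" by (simp add: d_def)
  finally have "cmod (of_real d - \<alpha>) \<le> d" using fi by simp
  then have "(cmod (of_real d - \<alpha>))\<^sup>2 \<le> d\<^sup>2" by (intro power_mono) auto
  then have "(Re \<alpha>)\<^sup>2 + (Im \<alpha>)\<^sup>2 \<le> 2 * d * Re \<alpha>"
    unfolding cmod_power2 by (simp add: power2_eq_square algebra_simps)
  moreover have "(Re \<alpha>)\<^sup>2 + (Im \<alpha>)\<^sup>2 > 0"
    using \<open>\<alpha> \<noteq> 0\<close> by (simp add: complex_eq_iff sum_power2_gt_zero_iff)
  ultimately have "0 < d * Re \<alpha>" by linarith
  then show ?thesis by (simp add: zero_less_mult_iff d_def)
qed

section \<open>Trajectories of the closed loop\<close>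

lemma agent_dynamics_components:
  "vec_nth (A_mat *v z + c *\<^sub>R B_vec) 1 = 2 * c"
  "vec_nth (A_mat *v z + c *\<^sub>R B_vec) 2 = vec_nth z 1"
  "inner C_vec z = (vec_nth z 1 + vec_nth z 2) / 2"
  by (simp_all add: A_mat_def B_vec_def C_vec_def matrix_vector_mult_def sum_2 inner_vec_def)

text \<open>The factor 2 in \<open>B_vec\<close> cancels the 1/2 in \<open>C_vec\<close>, which
  leaves \<open>q'' = - k L (q' + q)\<close> row by row, with \<open>q\<close> the second component
  and \<open>q'\<close> the first.\<close>

lemma closed_loop_components:
  assumes net: "agent_network N x u y" and fb: "output_feedback N G k u y"
    and nb: "neighbours G i \<subseteq> {1..N}" and i: "i \<in> {1..N}" and t: "t \<ge> 0"
  shows "((\<lambda>t. vec_nth (x i t) 2) has_vector_derivative vec_nth (x i t) 1) (at t within {0..})"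
    and "((\<lambda>t. vec_nth (x i t) 1) has_vector_derivative
      - k * (\<Sum>j\<in>neighbours G i. (vec_nth (x i t) 1 + vec_nth (x i t) 2)
        - (vec_nth (x j t) 1 + vec_nth (x j t) 2))) (at t within {0..})"
proof -
  have deriv: "(x i has_vector_derivative (A_mat *v x i t + u i t *\<^sub>R B_vec)) (at t within {0..})"
    using net i t by (simp add: agent_network_def)
  have y: "y j t = (vec_nth (x j t) 1 + vec_nth (x j t) 2) / 2" if "j \<in> {1..N}" for j
    using net that t by (simp add: agent_network_def agent_dynamics_components)
  have "2 * u i t = - k * (2 * (\<Sum>j\<in>neighbours G i. y i t - y j t))"
    using fb i t by (simp add: output_feedback_def)
  also have "2 * (\<Sum>j\<in>neighbours G i. y i t - y j t) = (\<Sum>j\<in>neighbours G i. 2 * (y i t - y j t))"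
    by (rule sum_distrib_left)
  also have "(\<Sum>j\<in>neighbours G i. 2 * (y i t - y j t)) = (\<Sum>j\<in>neighbours G i.
      (vec_nth (x i t) 1 + vec_nth (x i t) 2) - (vec_nth (x j t) 1 + vec_nth (x j t) 2))"
  proof (rule sum.cong[OF refl])
    fix j assume "j \<in> neighbours G i"
    with nb have "j \<in> {1..N}" by blast
    with y[OF i] y[of j] show "2 * (y i t - y j t) =
      (vec_nth (x i t) 1 + vec_nth (x i t) 2) - (vec_nth (x j t) 1 + vec_nth (x j t) 2)" by simp
  qed
  finally have u: "2 * u i t = - k * (\<Sum>j\<in>neighbours G i.
      (vec_nth (x i t) 1 + vec_nth (x i t) 2) - (vec_nth (x j t) 1 + vec_nth (x j t) 2))" .
  show "((\<lambda>t. vec_nth (x i t) 2) has_vector_derivative vec_nth (x i t) 1) (at t within {0..})"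
    using bounded_linear.has_vector_derivative[OF bounded_linear_vec_nth[of 2] deriv]
    by (simp only: agent_dynamics_components)
  show "((\<lambda>t. vec_nth (x i t) 1) has_vector_derivative
      - k * (\<Sum>j\<in>neighbours G i. (vec_nth (x i t) 1 + vec_nth (x i t) 2)
        - (vec_nth (x j t) 1 + vec_nth (x j t) 2))) (at t within {0..})"
    using bounded_linear.has_vector_derivative[OF bounded_linear_vec_nth[of 1] deriv]
    by (simp only: agent_dynamics_components u)
qed

text \<open>The condition on \<open>s\<close> is the characteristic equation
  \<open>s\<^sup>2 + k \<alpha> s + k \<alpha> = 0\<close>, so \<open>exp (s t) f\<close> solves the
  complexified loop. The loop is linear with real coefficients, hence the real part solves it
  too.\<close>

lemma exponential_mode_trajectory:
  fixes f :: "nat \<Rightarrow> complex"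
  assumes nb: "\<And>i. neighbours G i \<subseteq> {1..N}"
    and eig: "\<And>i. i \<in> {1..N} \<Longrightarrow> \<alpha> * f i = (\<Sum>j\<in>neighbours G i. f i - f j)"
    and s: "s * s = - (of_real k * \<alpha>) * (s + 1)"
  obtains x u y where "agent_network N x u y" "output_feedback N G k u y"
    "\<And>i t. vec_nth (x i t) 2 = Re (exp (t *\<^sub>R s) * f i)"
proof
  define q where "q = (\<lambda>i t. Re (exp (t *\<^sub>R s) * f i))"
  define p where "p = (\<lambda>i t. Re (exp (t *\<^sub>R s) * s * f i))"
  define x where "x = (\<lambda>i t. p i t *\<^sub>R axis 1 1 + q i t *\<^sub>R axis 2 1 :: real^2)"
  define y where "y = (\<lambda>i t. inner C_vec (x i t))"
  define u where "u = (\<lambda>i t. - k * (\<Sum>j\<in>neighbours G i. y i t - y j t))"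
  have x1: "vec_nth (x i t) 1 = p i t" and x2: "vec_nth (x i t) 2 = q i t" for i t
    by (simp_all add: x_def axis_def)
  show "vec_nth (x i t) 2 = Re (exp (t *\<^sub>R s) * f i)" for i t
    by (simp add: x2 q_def)
  show "output_feedback N G k u y" by (simp add: output_feedback_def u_def)
  have e: "((\<lambda>t. Re (exp (t *\<^sub>R s) * c)) has_vector_derivative Re (exp (t *\<^sub>R s) * s * c))
      (at t within {0..})" for c t
    by (intro bounded_linear.has_vector_derivative[OF bounded_linear_Re]
        has_vector_derivative_mult_left exp_scaleR_has_vector_derivative_right)
  have y: "y i t = Re (exp (t *\<^sub>R s) * (s + 1) * f i) / 2" for i t
    by (simp add: y_def agent_dynamics_components x1 x2 p_def q_def algebra_simps)
  have u: "2 * u i t = Re (exp (t *\<^sub>R s) * s * (s * f i))" if "i \<in> {1..N}" for i t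
  proof -
    have "2 * u i t = - k * (2 * (\<Sum>j\<in>neighbours G i. y i t - y j t))"
      by (simp add: u_def)
    also have "2 * (\<Sum>j\<in>neighbours G i. y i t - y j t) = (\<Sum>j\<in>neighbours G i. 2 * (y i t - y j t))"
      by (rule sum_distrib_left)
    also have "\<dots> = (\<Sum>j\<in>neighbours G i. Re (exp (t *\<^sub>R s) * (s + 1) * (f i - f j)))"
    proof (rule sum.cong[OF refl])
      fix j
      have "Re (exp (t *\<^sub>R s) * (s + 1) * (f i - f j))
          = Re (exp (t *\<^sub>R s) * (s + 1) * f i) - Re (exp (t *\<^sub>R s) * (s + 1) * f j)"
        by (simp only: right_diff_distrib minus_complex.sel)
      moreover have "2 * (a / 2 - b / 2) = a - b" for a b :: real by simp
      ultimately show "2 * (y i t - y j t) = Re (exp (t *\<^sub>R s) * (s + 1) * (f i - f j))"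
        by (simp only: y)
    qed
    also have "\<dots> = Re (exp (t *\<^sub>R s) * (s + 1) * (\<alpha> * f i))"
      by (simp only: eig[OF that] sum_distrib_left Re_sum)
    also have "- k * Re (exp (t *\<^sub>R s) * (s + 1) * (\<alpha> * f i)) = Re (of_real (- k) * (exp (t *\<^sub>R s) * (s + 1) * (\<alpha> * f i)))"
      by (simp only: Re_complex_of_real Im_complex_of_real times_complex.sel)
    also have "of_real (- k) * (exp (t *\<^sub>R s) * (s + 1) * (\<alpha> * f i))
        = exp (t *\<^sub>R s) * (- (of_real k * \<alpha>) * (s + 1)) * f i"
      by (simp add: algebra_simps)
    also have "\<dots> = exp (t *\<^sub>R s) * s * (s * f i)" unfolding s[symmetric] by (simp add: mult_ac)
    finally show ?thesis .
  qed
  show "agent_network N x u y"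
    unfolding agent_network_def
  proof (intro ballI allI impI conjI)
    fix i t assume i: "i \<in> {1..N}" and "(t::real) \<ge> 0"
    have "(p i has_vector_derivative Re (exp (t *\<^sub>R s) * s * (s * f i))) (at t within {0..})"
      using e[of "s * f i" t] by (simp add: p_def mult_ac)
    moreover have "(q i has_vector_derivative p i t) (at t within {0..})"
      using e[of "f i" t] by (simp add: p_def q_def)
    ultimately have "(x i has_vector_derivative
        (Re (exp (t *\<^sub>R s) * s * (s * f i)) *\<^sub>R axis 1 1 + p i t *\<^sub>R axis 2 1)) (at t within {0..})"
      unfolding x_def
      by (intro has_vector_derivative_add bounded_linear.has_vector_derivative[OF bounded_linear_scaleR_left])
    also have "Re (exp (t *\<^sub>R s) * s * (s * f i)) *\<^sub>R axis 1 1 + p i t *\<^sub>R axis 2 1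
        = A_mat *v x i t + u i t *\<^sub>R B_vec"
      unfolding u[OF i, symmetric]
      by (simp only: Finite_Cartesian_Product.vec_eq_iff forall_2 agent_dynamics_components x1) (simp add: axis_def)
    finally show "(x i has_vector_derivative (A_mat *v x i t + u i t *\<^sub>R B_vec)) (at t within {0..})" .
  qed (simp add: y_def)
qed

section \<open>Simplicity of the eigenvalue 0\<close>

text \<open>Of the \<open>n\<close> roots exactly \<open>n - 1\<close> are nonzero, so one zero
  remains. It is put first in the list because the Schur triangularisation needs it at index
  0.\<close>

lemma char_poly_simple_zero:
  fixes M :: "complex mat"
  assumes M: "M \<in> carrier_mat n n" and n: "n > 0"
    and es: "length es = n - 1" "mset es = filter_mset (\<lambda>z. z \<noteq> 0) (proots (char_poly M))"
  shows "char_poly M = (\<Prod>a\<leftarrow>0 # es. [:- a, 1:])"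
proof -
  obtain as where as: "char_poly M = (\<Prod>a\<leftarrow>as. [:- a, 1:])" "length as = n"
    using char_poly_factorized[OF M] by blast
  have "proots (\<Prod>a\<leftarrow>as. [:- a, 1:]) = mset as" for as :: "complex list"
  proof (induction as)
    case (Cons a as)
    have "(\<Prod>a\<leftarrow>as. [:- a, 1:]) \<noteq> 0" by (auto simp: prod_list_zero_iff)
    then show ?case using Cons by (simp add: proots_mult del: mult_pCons_left)
  qed simp
  with as have ms: "mset as = filter_mset (\<lambda>z. z \<noteq> 0) (mset as) + filter_mset (\<lambda>z. \<not> z \<noteq> 0) (mset as)"
    and es': "mset es = filter_mset (\<lambda>z. z \<noteq> 0) (mset as)"
    using es(2) by (simp_all flip: multiset_partition)
  define Z where "Z = filter_mset (\<lambda>z. \<not> z \<noteq> 0) (mset as)"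
  have "size Z = 1"
    using arg_cong[OF ms, of size] as(2) es(1) n unfolding Z_def[symmetric] es'[symmetric] by simp
  then obtain z where "Z = {#z#}" using size_1_singleton_mset by blast
  moreover have "z = 0" if "z \<in># Z" for z using that by (simp add: Z_def)
  ultimately have "Z = {#0#}" by auto
  then have "mset as = mset (0 # es)"
    using ms unfolding Z_def[symmetric] es'[symmetric] by simp
  then have "mset (map (\<lambda>a. [:- a, 1:]) as) = mset (map (\<lambda>a. [:- a, 1:]) (0 # es))"
    by (simp only: mset_map)
  then show ?thesis unfolding as(1) by (metis prod_mset_prod_list)
qed

section \<open>Equivalence of consensus and the gain bound\<close>

theorem theorem5:
  fixes N :: nat and k :: real and G :: "nat pair_pre_digraph" and lam :: "nat \<Rightarrow> complex"
  assumes "N \<ge> 2" and "k > 0"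
    and "pair_digraph G" and "pverts G = {1..N}"
    and "\<exists>T. directed_spanning_tree T G"
    and "image_mset lam (mset_set {1..N-1}) =
           filter_mset (\<lambda>z. z \<noteq> 0) (eigenvalue_mset (laplace_matrix N G))"
  shows "(\<forall>x0 :: nat \<Rightarrow> real^2. \<forall>x u y.
            agent_network N x u y \<and> output_feedback N G k u y \<and> (\<forall>i\<in>{1..N}. x i 0 = x0 i) \<longrightarrow>
            (\<forall>i\<in>{1..N}. \<forall>j\<in>{1..N}. ((\<lambda>t. x i t - x j t) \<longlongrightarrow> 0) at_top))
         \<longleftrightarrow> k > (MAX j\<in>{1..N-1}. (sin (Arg (lam j)))\<^sup>2 / Re (lam j))"
    (is "?consensus \<longleftrightarrow> ?gain")
proof -
  note nb = neighbours_subset[OF assms(3,4)]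
  define L where "L = map_mat complex_of_real (laplace_matrix N G)"
  have L: "L \<in> carrier_mat N N"
    by (simp add: L_def laplace_matrix_def adjacency_matrix_def minus_carrier_mat)
  have row: "(\<Sum>j<N. L $$ (i, j) * f (Suc j)) = (\<Sum>j\<in>neighbours G (Suc i). f (Suc i) - f j)"
    if "i < N" for i and f :: "nat \<Rightarrow> complex"
  proof -
    have "L $$ (i, j) = complex_of_real (laplace_matrix N G $$ (i, j))" if "j < N" for j
      using that \<open>i < N\<close> L by (simp add: L_def)
    then show ?thesis using laplace_matrix_row[OF nb that, of f] by simp
  qed
  \<comment> \<open>Only the set of nonzero eigenvalues is needed here; the multiplicities enter
    later, through \<open>cp\<close>.\<close>
  have spectrum: "lam ` {1..N-1} = {z. z \<noteq> 0 \<and> poly (char_poly L) z = 0}"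
  proof -
    have "char_poly L \<noteq> 0" using degree_monic_char_poly[OF L] by auto
    then show ?thesis
      using arg_cong[OF assms(6), of set_mset]
      by (simp add: eigenvalue_mset_def L_def[symmetric] set_mset_filter Collect_conj_eq Int_commute)
  qed
  have eigenfunction: "\<exists>f. (\<forall>i\<in>{1..N}. \<alpha> * f i = (\<Sum>j\<in>neighbours G i. f i - f j)) \<and> (\<exists>i\<in>{1..N}. f i \<noteq> 0)"
    if \<alpha>: "\<alpha> \<in> lam ` {1..N-1}" for \<alpha>
  proof -
    obtain v where v: "v \<in> carrier_vec N" "v \<noteq> 0\<^sub>v N" "L *\<^sub>v v = \<alpha> \<cdot>\<^sub>v v"
    proof -
      have "eigenvalue L \<alpha>"
        using \<alpha> eigenvalue_root_char_poly[OF L] unfolding spectrum by simp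
      then show ?thesis using L that unfolding eigenvalue_def eigenvector_def by auto
    qed
    \<comment> \<open>The shift from agents back to matrix indices; truncation at
      \<open>i = 0\<close> is harmless, as 0 is not an agent.\<close>
    define f where "f = (\<lambda>i. vec_index v (i - 1))"
    have "\<alpha> * f i = (\<Sum>j\<in>neighbours G i. f i - f j)" if i: "i \<in> {1..N}" for i
    proof -
      obtain m where m: "i = Suc m" "m < N" using i by (cases i) auto
      have "vec_index (L *\<^sub>v v) m = (\<Sum>j<N. L $$ (m, j) * vec_index v j)"
        using v(1) L m by (simp add: scalar_prod_def atLeast0LessThan)
      moreover have "vec_index (L *\<^sub>v v) m = \<alpha> * vec_index v m"
        using v m by simp
      ultimately show ?thesis using row[OF m(2), of f] by (simp add: f_def m)
    qed
    moreover have "\<exists>i\<in>{1..N}. f i \<noteq> 0"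
    proof (rule ccontr)
      assume "\<not> ?thesis"
      then have "vec_index v m = 0" if "m < N" for m
        using that by (auto simp: f_def dest: bspec[of _ _ "Suc m"])
      with v(1) have "v = 0\<^sub>v N" by auto
      with v(2) show False by simp
    qed
    ultimately show ?thesis by blast
  qed
  have Re_pos: "Re \<alpha> > 0" if \<alpha>: "\<alpha> \<in> lam ` {1..N-1}" for \<alpha>
    using eigenfunction[OF \<alpha>] laplace_eigenvalue_Re_pos[OF nb, of \<alpha>] \<alpha>[unfolded spectrum]
    by blast
  \<comment> \<open>The factor \<open>k > 0\<close> leaves \<open>Arg\<close> unchanged and scales
    \<open>Re\<close>; division by \<open>Re \<alpha> > 0\<close> then isolates
    \<open>k\<close>.\<close>
  have roots: "\<exists>s\<^sub>1 s\<^sub>2. s\<^sub>1 + s\<^sub>2 = - (of_real k * \<alpha>) \<and> s\<^sub>1 * s\<^sub>2 = of_real k * \<alpha> \<and>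
      (k > (sin (Arg \<alpha>))\<^sup>2 / Re \<alpha> \<longleftrightarrow> Re s\<^sub>1 < 0 \<and> Re s\<^sub>2 < 0)" if "\<alpha> \<in> lam ` {1..N-1}" for \<alpha>
  proof -
    have "of_real k * \<alpha> \<noteq> 0" using Re_pos[OF that] \<open>k > 0\<close> by auto
    from hurwitz_condition[OF this] obtain s\<^sub>1 s\<^sub>2 where
      s: "s\<^sub>1 + s\<^sub>2 = - (of_real k * \<alpha>)" "s\<^sub>1 * s\<^sub>2 = of_real k * \<alpha>"
      and h: "Re (of_real k * \<alpha>) > (sin (Arg (of_real k * \<alpha>)))\<^sup>2 \<longleftrightarrow> Re s\<^sub>1 < 0 \<and> Re s\<^sub>2 < 0" by blast
    have "Arg (of_real k * \<alpha>) = Arg \<alpha>" using \<open>k > 0\<close> by (simp add: Arg_times_of_real)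
    then have "k > (sin (Arg \<alpha>))\<^sup>2 / Re \<alpha> \<longleftrightarrow> Re s\<^sub>1 < 0 \<and> Re s\<^sub>2 < 0"
      using h Re_pos[OF that] by (simp add: pos_divide_less_eq)
    with s show ?thesis by blast
  qed
  \<comment> \<open>\<open>N \<ge> 2\<close> makes the index set nonempty, as
    \<open>Max_less_iff\<close> requires.\<close>
  have gain: "?gain \<longleftrightarrow> (\<forall>\<alpha>\<in>lam ` {1..N-1}. k > (sin (Arg \<alpha>))\<^sup>2 / Re \<alpha>)"
    using \<open>N \<ge> 2\<close> by (subst Max_less_iff) auto
  show ?thesis
  proof
    assume gainL: ?gain
    show ?consensus
    proof (intro allI impI ballI, elim conjE)
      fix x0 x :: "nat \<Rightarrow> _" and u y i j
      assume net: "agent_network N x u y" and fb: "output_feedback N G k u y"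
        and i: "i \<in> {1..N}" and j: "j \<in> {1..N}"
      note loop = closed_loop_components[OF net fb nb]
      obtain es where es: "mset es = image_mset lam (mset_set {1..N-1})"
        using ex_mset by blast
      then have "length es = N - 1" by (simp flip: size_mset)
      then have cp: "char_poly L = (\<Prod>a\<leftarrow>0 # es. [:- a, 1:])"
        using \<open>N \<ge> 2\<close> assms(6) es
        by (intro char_poly_simple_zero[OF L]) (auto simp: eigenvalue_mset_def L_def)
      have set_es: "set es = lam ` {1..N-1}" using arg_cong[OF es, of set_mset] by simp
      define q where "q = (\<lambda>i t. complex_of_real (vec_nth (x (Suc i) t) 2))"
      define p where "p = (\<lambda>i t. complex_of_real (vec_nth (x (Suc i) t) 1))"
      have q: "(q m has_vector_derivative p m t) (at t within {0..})" if "m < N" "t \<ge> 0" for m t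
        using loop(1)[of "Suc m" t] that unfolding q_def p_def
        by (intro bounded_linear.has_vector_derivative[OF bounded_linear_of_real]) auto
      have p: "(p m has_vector_derivative - of_real k * (\<Sum>j<N. L $$ (m, j) * (p j t + q j t)))
          (at t within {0..})" if "m < N" "t \<ge> 0" for m t
      proof -
        have "(p m has_vector_derivative of_real (- k * (\<Sum>j\<in>neighbours G (Suc m).
            (vec_nth (x (Suc m) t) 1 + vec_nth (x (Suc m) t) 2) - (vec_nth (x j t) 1 + vec_nth (x j t) 2))))
            (at t within {0..})"
          unfolding p_def using that
          by (intro bounded_linear.has_vector_derivative[OF bounded_linear_of_real] loop(2)) auto
        then show ?thesis
          using row[OF that(1), of "\<lambda>j. complex_of_real (vec_nth (x j t) 1 + vec_nth (x j t) 2)"]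
          by (simp add: p_def q_def)
      qed
      obtain a b where ab: "i = Suc a" "a < N" "j = Suc b" "b < N"
        using i j by (cases i; cases j) auto
      have "((\<lambda>t. q a t - q b t) \<longlongrightarrow> 0) at_top \<and> ((\<lambda>t. p a t - p b t) \<longlongrightarrow> 0) at_top"
      proof -
        have "0 \<notin> set es" unfolding set_es spectrum by simp
        moreover have "(\<Sum>j<N. L $$ (m, j)) = 0" if "m < N" for m
          using row[OF that, of "\<lambda>_. 1"] by simp
        moreover have "\<exists>s\<^sub>1 s\<^sub>2. Re s\<^sub>1 < 0 \<and> Re s\<^sub>2 < 0 \<and> s\<^sub>1 + s\<^sub>2 = - (of_real k * \<alpha>) \<and> s\<^sub>1 * s\<^sub>2 = of_real k * \<alpha>"
          if "\<alpha> \<in> set es" for \<alpha>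
          using roots[of \<alpha>] gainL that unfolding gain set_es by blast
        ultimately show ?thesis
          using consensus_of_stable_modes[OF L _ cp _ _ q p ab(2,4)] by blast
      qed
      then have "((\<lambda>t. vec_nth (x i t - x j t) c) \<longlongrightarrow> 0) at_top" for c :: 2
        using exhaust_2[of c] unfolding q_def p_def ab
        by (auto simp flip: of_real_diff simp: tendsto_of_real_iff[where c = 0, simplified])
      then show "((\<lambda>t. x i t - x j t) \<longlongrightarrow> 0) at_top"
        by (intro vec_tendstoI) simp
    qed
  next
    assume consensus: ?consensus
    show ?gain
    proof (rule ccontr)
      assume "\<not> ?gain"
      then obtain \<alpha> where \<alpha>: "\<alpha> \<in> lam ` {1..N-1}" and bad: "\<not> k > (sin (Arg \<alpha>))\<^sup>2 / Re \<alpha>"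
        unfolding gain by blast
      obtain s\<^sub>1 s\<^sub>2 where s12: "s\<^sub>1 + s\<^sub>2 = - (of_real k * \<alpha>)" "s\<^sub>1 * s\<^sub>2 = of_real k * \<alpha>"
        and "\<not> (Re s\<^sub>1 < 0 \<and> Re s\<^sub>2 < 0)"
        using roots[OF \<alpha>] bad by blast
      \<comment> \<open>By Vieta each root satisfies the characteristic equation, so whichever is
        unstable can serve as \<open>s\<close>.\<close>
      moreover have "s\<^sub>1 * s\<^sub>1 = (s\<^sub>1 + s\<^sub>2) * s\<^sub>1 - s\<^sub>1 * s\<^sub>2" "s\<^sub>2 * s\<^sub>2 = (s\<^sub>1 + s\<^sub>2) * s\<^sub>2 - s\<^sub>1 * s\<^sub>2"
        by (simp_all add: algebra_simps)
      then have "s\<^sub>1 * s\<^sub>1 = - (of_real k * \<alpha>) * (s\<^sub>1 + 1)" "s\<^sub>2 * s\<^sub>2 = - (of_real k * \<alpha>) * (s\<^sub>2 + 1)"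
        unfolding s12 by (simp_all only: distrib_left mult_1_right diff_conv_add_uminus)
      ultimately obtain s where s: "s * s = - (of_real k * \<alpha>) * (s + 1)" and Re_s: "Re s \<ge> 0"
        by (meson not_less)
      obtain f where f: "\<And>i. i \<in> {1..N} \<Longrightarrow> \<alpha> * f i = (\<Sum>j\<in>neighbours G i. f i - f j)"
        and fnz: "\<exists>i\<in>{1..N}. f i \<noteq> 0"
        using eigenfunction[OF \<alpha>] by blast
      have Re_lim: "((\<lambda>t. Re (exp (t *\<^sub>R s) * (c * f i)) - Re (exp (t *\<^sub>R s) * (c * f j))) \<longlongrightarrow> 0) at_top"
        if "i \<in> {1..N}" "j \<in> {1..N}" for i j c
      proof -
        have "\<alpha> * (c * f i) = (\<Sum>j\<in>neighbours G i. c * f i - c * f j)" if "i \<in> {1..N}" for i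
        proof -
          have "\<alpha> * (c * f i) = c * (\<alpha> * f i)" by (simp only: mult.left_commute)
          also have "\<dots> = (\<Sum>j\<in>neighbours G i. c * f i - c * f j)"
            by (simp only: f[OF that] sum_distrib_left right_diff_distrib)
          finally show ?thesis .
        qed
        then obtain x u y where "agent_network N x u y" "output_feedback N G k u y"
          and x2: "\<And>i t. vec_nth (x i t) 2 = Re (exp (t *\<^sub>R s) * (c * f i))"
          using exponential_mode_trajectory[OF nb _ s, of "\<lambda>i. c * f i"] by blast
        then have "((\<lambda>t. x i t - x j t) \<longlongrightarrow> 0) at_top"
          using consensus[rule_format, of x u y "\<lambda>i. x i 0"] that by simp
        from tendsto_vec_nth[OF this, of 2] show ?thesis by (simp add: x2)
      qed
      \<comment> \<open>The choices \<open>c = 1\<close> and \<open>c = \<i>\<close> yield the real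
        part and minus the imaginary part of \<open>exp (s t) (f i - f j)\<close>, so this tends to
        0; since \<open>Re s \<ge> 0\<close>, its modulus stays at least that of
        \<open>f i - f j\<close>.\<close>
      have equal: "f i = f j" if ij: "i \<in> {1..N}" "j \<in> {1..N}" for i j
      proof -
        have "((\<lambda>t. Re (exp (t *\<^sub>R s) * (f i - f j))) \<longlongrightarrow> 0) at_top"
          using Re_lim[OF ij, of 1] by (simp add: right_diff_distrib)
        moreover
        have "((\<lambda>t. - Im (exp (t *\<^sub>R s) * (f i - f j))) \<longlongrightarrow> 0) at_top"
          using Re_lim[OF ij, of \<i>] by (simp add: algebra_simps)
        from tendsto_minus[OF this] have "((\<lambda>t. Im (exp (t *\<^sub>R s) * (f i - f j))) \<longlongrightarrow> 0) at_top"
          by (simp only: minus_minus minus_zero)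
        ultimately have "((\<lambda>t. exp (t *\<^sub>R s) * (f i - f j)) \<longlongrightarrow> 0) at_top"
          unfolding tendsto_complex_iff zero_complex.sel by blast
        then have "((\<lambda>t. cmod (exp (t *\<^sub>R s) * (f i - f j))) \<longlongrightarrow> 0) at_top"
          by (rule tendsto_norm_zero)
        moreover have "eventually (\<lambda>t. cmod (f i - f j) \<le> cmod (exp (t *\<^sub>R s) * (f i - f j))) at_top"
          using eventually_ge_at_top[of 0]
        proof eventually_elim
          case (elim t)
          then have "1 * cmod (f i - f j) \<le> exp (t * Re s) * cmod (f i - f j)"
            using Re_s by (intro mult_right_mono) auto
          then show ?case by (simp add: norm_mult)
        qed
        ultimately have "cmod (f i - f j) \<le> 0"
          by (rule tendsto_lowerbound) simp
        then show ?thesis by simp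
      qed
      obtain i where i: "i \<in> {1..N}" "f i \<noteq> 0" using fnz by blast
      \<comment> \<open>A constant eigenfunction would belong to the eigenvalue 0, whereas
        \<open>\<alpha>\<close> is nonzero.\<close>
      have "(\<Sum>j\<in>neighbours G i. f i - f j) = 0"
        using equal[OF i(1)] nb[of i] by (intro sum.neutral) (auto simp: subset_iff)
      then have "\<alpha> * f i = 0" using f[OF i(1)] by simp
      then show False using i(2) \<alpha>[unfolded spectrum] by simp
    qed
  qed
qed

end
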